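(* Let $\tau$ be an operator system tensor product that commutes with inductive limits, and let $$\mathcal S_1\xrightarrow{\phi_1}\mathcal S_2\xrightarrow{\phi_2}\mathcal S_3\xrightarrow{\phi_3}\cdots\qquad\text{and}\qquad\mathcal T_1\xrightarrow{\psi_1}\mathcal T_2\xrightarrow{\psi_2}\mathcal T_3\xrightarrow{\psi_3}\cdots$$ be inductive sequences in the operator system category with inductive limits $\mathcal S$ and $\mathcal T$, respectively. Then $$\varinjlim(\mathcal S_k\otimes_\tau\mathcal T_k)\cong\mathcal S\otimes_\tau\mathcal T,$$ up to a canonical complete order isomorphism.
   Context: The operator system category has operator systems as objects and unital completely positive (u.c.p.) maps as morphisms. An inductive sequence is a sequence of operator systems $\mathcal S_k$ with u.c.p. connecting maps $\phi_k:\mathcal S_k\to\mathcal S_{k+1}$, $k\in\mathbb N$. Its inductive limit is an operator system $\mathcal S=\varinjlim\mathcal S_k$ together with u.c.p. maps $\phi_{k,\infty}:\mathcal S_k\to\mathcal S$, $\phi_{k+1,\infty}\circ\phi_k=\phi_{k,\infty}$, such that for any operator system $\mathcal R$ and u.c.p. maps $\rho_k:\mathcal S_k\to\mathcal R$ with $\rho_{k+1}\circ\phi_k=\rho_k$ for all $k$, there is a unique u.c.p. map $\rho:\mathcal S\to\mathcal R$ with $\rho\circ\phi_{k,\infty}=\rho_k$ for all $k$. An operator system tensor product $\tau$ (in the sense of Kavruk, Paulsen, Todorov and Tomforde) assigns to each pair $(\mathcal S,\mathcal T)$ of operator systems an operator system $\mathcal S\otimes_\tau\mathcal T$ whose underlying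 space is the algebraic tensor product $\mathcal S\otimes\mathcal T$ and whose unit is $1\otimes1$, such that $P\otimes Q\in M_{nm}(\mathcal S\otimes_\tau\mathcal T)^+$ whenever $P\in M_n(\mathcal S)^+$, $Q\in M_m(\mathcal T)^+$, and $\phi\otimes\psi:\mathcal S\otimes_\tau\mathcal T\to M_{nm}$ is u.c.p. whenever $\phi:\mathcal S\to M_n$ and $\psi:\mathcal T\to M_m$ are u.c.p. The tensor product $\tau$ is said to commute with inductive limits if, for every inductive sequence $\mathcal S_1\xrightarrow{\phi_1}\mathcal S_2\xrightarrow{\phi_2}\mathcal S_3\xrightarrow{\phi_3}\cdots$ in the operator system category and every operator system $\mathcal T$, one has $\varinjlim(\mathcal S_k\otimes_\tau\mathcal T)\cong(\varinjlim\mathcal S_k)\otimes_\tau\mathcal T$, up to a canonical complete order isomorphism. The inductive limits $\varinjlim(\mathcal S_k\otimes_\tau\mathcal T)$ and $\varinjlim(\mathcal S_k\otimes_\tau\mathcal T_k)$ are taken along the connecting maps $\phi_k\otimes{\rm id}_{\mathcal T}$ and $\phi_k\otimes\psi_k$, respectively.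
   Formalization: "Commutes with inductive limits" is required in both variables, i.e. also lim(T ⊗ S_k) ≅ T ⊗ (lim S_k) canonically; with the first variable alone the claim fails, e.g. for the tensor product er, and for constant S_k the conclusion is exactly this condition. *)

theory Defs
  imports "Jordan_Normal_Form.Schur_Decomposition"
begin

hide_const (open) Multiset.mult Polynomial.smult

section \<open>Operator systems\<close>

text \<open>
  Operator systems are the abstract ones of Choi and Effros: a complex *-vector space with
  matrix cones and an Archimedean matrix order unit.  The record extends the modules of HOL-Algebra;
  its field \<^const>\<open>one\<close> is the order unit, and its field \<^const>\<open>mult\<close> is never referred to.
  The set \<open>pos S n\<close> is the cone of positive \<open>n\<close> by \<open>n\<close> matrices.  The size \<open>n = 0\<close> is
  admitted everywhere; it is harmless, because the axioms force \<open>pos S 0\<close> to consist of the only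
  matrix of that size.
\<close>

record 'a opsys = "(complex, 'a) module" +
  star :: "'a \<Rightarrow> 'a"
  pos :: "nat \<Rightarrow> 'a mat set"

definition matrices :: "('a, 'm) opsys_scheme \<Rightarrow> nat \<Rightarrow> 'a mat set" where
  "matrices S n = {A \<in> carrier_mat n n. elements_mat A \<subseteq> carrier S}"

definition mat_star :: "('a, 'm) opsys_scheme \<Rightarrow> 'a mat \<Rightarrow> 'a mat" where
  "mat_star S A = mat (dim_col A) (dim_row A) (\<lambda>(i, j). star S (A $$ (j, i)))"

definition hermitian_matrices :: "('a, 'm) opsys_scheme \<Rightarrow> nat \<Rightarrow> 'a mat set" where
  "hermitian_matrices S n = {A \<in> matrices S n. mat_star S A = A}"

definition mat_add :: "('a, 'm) opsys_scheme \<Rightarrow> 'a mat \<Rightarrow> 'a mat \<Rightarrow> 'a mat" where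
  "mat_add S A B = mat (dim_row A) (dim_col A) (\<lambda>ij. A $$ ij \<oplus>\<^bsub>S\<^esub> B $$ ij)"

definition mat_scale :: "('a, 'm) opsys_scheme \<Rightarrow> complex \<Rightarrow> 'a mat \<Rightarrow> 'a mat" where
  "mat_scale S c A = map_mat (\<lambda>x. c \<odot>\<^bsub>S\<^esub> x) A"

definition mat_unit :: "('a, 'm) opsys_scheme \<Rightarrow> nat \<Rightarrow> 'a mat" where
  "mat_unit S n = mat n n (\<lambda>(i, j). if i = j then \<one>\<^bsub>S\<^esub> else \<zero>\<^bsub>S\<^esub>)"

definition mat_zero :: "('a, 'm) opsys_scheme \<Rightarrow> nat \<Rightarrow> 'a mat" where
  "mat_zero S n = mat n n (\<lambda>_. \<zero>\<^bsub>S\<^esub>)"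

text \<open>The matrix \<open>X\<^sup>* A X\<close> for a scalar matrix \<open>X\<close> and a matrix \<open>A\<close> over \<open>S\<close>.\<close>

definition compress :: "('a, 'm) opsys_scheme \<Rightarrow> complex mat \<Rightarrow> 'a mat \<Rightarrow> 'a mat" where
  "compress S X A = mat (dim_col X) (dim_col X) (\<lambda>(p, q).
     \<Oplus>\<^bsub>S\<^esub>i\<in>{..<dim_row X}. \<Oplus>\<^bsub>S\<^esub>j\<in>{..<dim_row X}.
       (cnj (X $$ (i, p)) * X $$ (j, q)) \<odot>\<^bsub>S\<^esub> A $$ (i, j))"

locale operator_system = vectorspace "class_ring :: complex ring" S for S :: "('a, 'm) opsys_scheme" +
  assumes star_closed: "x \<in> carrier S \<Longrightarrow> star S x \<in> carrier S"
    and star_star: "x \<in> carrier S \<Longrightarrow> star S (star S x) = x"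
    and star_add: "x \<in> carrier S \<Longrightarrow> y \<in> carrier S \<Longrightarrow>
      star S (x \<oplus>\<^bsub>S\<^esub> y) = star S x \<oplus>\<^bsub>S\<^esub> star S y"
    and star_smult: "x \<in> carrier S \<Longrightarrow> star S (c \<odot>\<^bsub>S\<^esub> x) = cnj c \<odot>\<^bsub>S\<^esub> star S x"
    and pos_hermitian: "pos S n \<subseteq> hermitian_matrices S n"
    and pos_nonempty: "pos S n \<noteq> {}"
    and pos_add: "A \<in> pos S n \<Longrightarrow> B \<in> pos S n \<Longrightarrow> mat_add S A B \<in> pos S n"
    and pos_scale: "A \<in> pos S n \<Longrightarrow> 0 \<le> r \<Longrightarrow> mat_scale S (complex_of_real r) A \<in> pos S n"
    and pos_proper: "A \<in> pos S n \<Longrightarrow> mat_scale S (- 1) A \<in> pos S n \<Longrightarrow> A = mat_zero S n"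
    and pos_compress: "A \<in> pos S n \<Longrightarrow> X \<in> carrier_mat n m \<Longrightarrow> compress S X A \<in> pos S m"
    and unit_closed: "\<one>\<^bsub>S\<^esub> \<in> carrier S"
    and star_unit: "star S \<one>\<^bsub>S\<^esub> = \<one>\<^bsub>S\<^esub>"
    and matrix_order_unit: "A \<in> hermitian_matrices S n \<Longrightarrow>
      \<exists>r>0. mat_add S (mat_scale S (complex_of_real r) (mat_unit S n)) A \<in> pos S n"
    and archimedean: "A \<in> hermitian_matrices S n \<Longrightarrow>
      (\<And>r. r > 0 \<Longrightarrow> mat_add S (mat_scale S (complex_of_real r) (mat_unit S n)) A \<in> pos S n) \<Longrightarrow>
      A \<in> pos S n"

abbreviation linear_maps :: "(complex, 'a, 'm) module_scheme \<Rightarrow> (complex, 'b, 'n) module_scheme \<Rightarrow>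
    ('a \<Rightarrow> 'b) set" where
  "linear_maps V W \<equiv> LinearCombinations.module_hom (class_ring :: complex ring) V W"

definition ucp :: "('a, 'm) opsys_scheme \<Rightarrow> ('b, 'n) opsys_scheme \<Rightarrow> ('a \<Rightarrow> 'b) \<Rightarrow> bool" where
  "ucp S T \<phi> \<longleftrightarrow>
     \<phi> \<in> linear_maps S T \<and>
     (\<forall>n. \<forall>A\<in>pos S n. map_mat \<phi> A \<in> pos T n) \<and>
     \<phi> \<one>\<^bsub>S\<^esub> = \<one>\<^bsub>T\<^esub>"

definition complete_order_iso ::
  "('a, 'm) opsys_scheme \<Rightarrow> ('b, 'n) opsys_scheme \<Rightarrow> ('a \<Rightarrow> 'b) \<Rightarrow> bool" where
  "complete_order_iso S T \<phi> \<longleftrightarrow>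
     bij_betw \<phi> (carrier S) (carrier T) \<and> ucp S T \<phi> \<and> ucp T S (inv_into (carrier S) \<phi>)"


section \<open>The operator systems of scalar matrices\<close>

definition positive_semidefinite :: "complex mat \<Rightarrow> bool" where
  "positive_semidefinite A \<longleftrightarrow>
     A \<in> carrier_mat (dim_row A) (dim_row A) \<and>
     (\<forall>v\<in>carrier_vec (dim_row A). 0 \<le> (A *\<^sub>v v) \<bullet>c v)"

text \<open>A \<open>k\<close> by \<open>k\<close> matrix of \<open>n\<close> by \<open>n\<close> matrices, read as a block matrix.\<close>

definition flatten_mat :: "nat \<Rightarrow> nat \<Rightarrow> 'a mat mat \<Rightarrow> 'a mat" where
  "flatten_mat k n A =
     mat (k * n) (k * n) (\<lambda>(i, j). (A $$ (i div n, j div n)) $$ (i mod n, j mod n))"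

definition scalar_matrices :: "nat \<Rightarrow> complex mat opsys" where
  "scalar_matrices n =
     \<lparr> carrier = carrier_mat n n, mult = (*), one = 1\<^sub>m n, zero = 0\<^sub>m n n, add = (+),
       smult = (\<cdot>\<^sub>m), star = mat_adjoint,
       pos = (\<lambda>k. {A \<in> carrier_mat k k. elements_mat A \<subseteq> carrier_mat n n \<and>
                     positive_semidefinite (flatten_mat k n A)}) \<rparr>"

text \<open>The Kronecker product of two matrices, entries being multiplied with \<open>t\<close>.\<close>

definition kronecker :: "('a \<Rightarrow> 'b \<Rightarrow> 'c) \<Rightarrow> 'a mat \<Rightarrow> 'b mat \<Rightarrow> 'c mat" where
  "kronecker t A B = mat (dim_row A * dim_row B) (dim_col A * dim_col B)
     (\<lambda>(i, j). t (A $$ (i div dim_row B, j div dim_col B)) (B $$ (i mod dim_row B, j mod dim_col B)))"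


section \<open>Tensor products\<close>

definition bilinear_map :: "(complex, 'a, 'l) module_scheme \<Rightarrow> (complex, 'b, 'm) module_scheme \<Rightarrow>
    (complex, 'c, 'n) module_scheme \<Rightarrow> ('a \<Rightarrow> 'b \<Rightarrow> 'c) \<Rightarrow> bool" where
  "bilinear_map S T W b \<longleftrightarrow>
     (\<forall>s\<in>carrier S. b s \<in> linear_maps T W) \<and>
     (\<forall>x\<in>carrier T. (\<lambda>s. b s x) \<in> linear_maps S W)"

text \<open>
  All operator systems of one statement have their elements in a common type \<open>'u\<close>, which is
  arbitrary and plays the part of a universe.  If a nonzero complex vector space has its elements in
  \<open>'u\<close>, then \<open>'u\<close> has at least the cardinality of the continuum, and algebraic tensor products
  and inductive limits of operator systems in \<open>'u\<close> have copies in \<open>'u\<close>.  The span of the image of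
  a bilinear map, as well as the operator system generated by countably many operator systems in
  \<open>'u\<close>, has a copy in \<open>'u\<close> too.  Hence it does not matter that the universal properties below
  are only tested on targets in \<open>'u\<close>.
\<close>

definition algebraic_tensor_product :: "(complex, 'u, 'l) module_scheme \<Rightarrow>
    (complex, 'u, 'm) module_scheme \<Rightarrow> (complex, 'u, 'n) module_scheme \<Rightarrow> ('u \<Rightarrow> 'u \<Rightarrow> 'u) \<Rightarrow> bool"
where
  "algebraic_tensor_product S T V t \<longleftrightarrow>
     vectorspace (class_ring :: complex ring) V \<and>
     bilinear_map S T V t \<and>
     (\<forall>(W :: (complex, 'u) module) b.
        vectorspace (class_ring :: complex ring) W \<and> bilinear_map S T W b \<longrightarrow>
        (\<exists>f\<in>linear_maps V W.
           (\<forall>s\<in>carrier S. \<forall>x\<in>carrier T. f (t s x) = b s x) \<and>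
           (\<forall>g\<in>linear_maps V W.
              (\<forall>s\<in>carrier S. \<forall>x\<in>carrier T. g (t s x) = b s x) \<longrightarrow>
              (\<forall>v\<in>carrier V. g v = f v))))"

text \<open>
  The linear map on the tensor product \<open>V\<close> of \<open>S\<close> and \<open>T\<close> induced by the bilinear map \<open>b\<close>.
  It is determined on \<open>carrier V\<close> only, and nothing below depends on its values elsewhere.
\<close>

definition induced_map :: "(complex, 'a, 'k) module_scheme \<Rightarrow> (complex, 'b, 'l) module_scheme \<Rightarrow>
    (complex, 'c, 'm) module_scheme \<Rightarrow> ('a \<Rightarrow> 'b \<Rightarrow> 'c) \<Rightarrow>
    (complex, 'd, 'n) module_scheme \<Rightarrow> ('a \<Rightarrow> 'b \<Rightarrow> 'd) \<Rightarrow> 'c \<Rightarrow> 'd" where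
  "induced_map S T V t W b =
     (SOME f. f \<in> linear_maps V W \<and>
              (\<forall>s\<in>carrier S. \<forall>x\<in>carrier T. f (t s x) = b s x))"

text \<open>
  A tensor product assigns to two operator systems an operator system together with the
  bilinear map that sends \<open>s\<close> and \<open>x\<close> to the elementary tensor of \<open>s\<close> and \<open>x\<close>.
\<close>

type_synonym 'u tensor = "'u opsys \<Rightarrow> 'u opsys \<Rightarrow> 'u opsys \<times> ('u \<Rightarrow> 'u \<Rightarrow> 'u)"

definition tensor_sys :: "'u tensor \<Rightarrow> 'u opsys \<Rightarrow> 'u opsys \<Rightarrow> 'u opsys" where
  "tensor_sys \<tau> S T = fst (\<tau> S T)"

definition elem_tensor :: "'u tensor \<Rightarrow> 'u opsys \<Rightarrow> 'u opsys \<Rightarrow> 'u \<Rightarrow> 'u \<Rightarrow> 'u" where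
  "elem_tensor \<tau> S T = snd (\<tau> S T)"

definition tensor_map :: "'u tensor \<Rightarrow> 'u opsys \<Rightarrow> 'u opsys \<Rightarrow> 'u opsys \<Rightarrow> 'u opsys \<Rightarrow>
    ('u \<Rightarrow> 'u) \<Rightarrow> ('u \<Rightarrow> 'u) \<Rightarrow> 'u \<Rightarrow> 'u" where
  "tensor_map \<tau> S T S' T' \<phi> \<psi> =
     induced_map S T (tensor_sys \<tau> S T) (elem_tensor \<tau> S T)
       (tensor_sys \<tau> S' T') (\<lambda>s x. elem_tensor \<tau> S' T' (\<phi> s) (\<psi> x))"

text \<open>
  The fourth clause describes the involution of the algebraic tensor product of two *-vector
  spaces.  The remaining clauses imply it, since positive elements span an operator system.
\<close>

definition operator_system_tensor_product :: "'u tensor \<Rightarrow> bool" where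
  "operator_system_tensor_product \<tau> \<longleftrightarrow>
     (\<forall>S T. operator_system S \<and> operator_system T \<longrightarrow>
        operator_system (tensor_sys \<tau> S T) \<and>
        algebraic_tensor_product S T (tensor_sys \<tau> S T) (elem_tensor \<tau> S T) \<and>
        \<one>\<^bsub>tensor_sys \<tau> S T\<^esub> = elem_tensor \<tau> S T \<one>\<^bsub>S\<^esub> \<one>\<^bsub>T\<^esub> \<and>
        (\<forall>s\<in>carrier S. \<forall>x\<in>carrier T.
           star (tensor_sys \<tau> S T) (elem_tensor \<tau> S T s x) =
             elem_tensor \<tau> S T (star S s) (star T x)) \<and>
        (\<forall>n m. \<forall>P\<in>pos S n. \<forall>Q\<in>pos T m.
           kronecker (elem_tensor \<tau> S T) P Q \<in> pos (tensor_sys \<tau> S T) (n * m)) \<and>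
        (\<forall>n m \<phi> \<psi>. ucp S (scalar_matrices n) \<phi> \<and> ucp T (scalar_matrices m) \<psi> \<longrightarrow>
           ucp (tensor_sys \<tau> S T) (scalar_matrices (n * m))
             (induced_map S T (tensor_sys \<tau> S T) (elem_tensor \<tau> S T)
                (scalar_matrices (n * m)) (\<lambda>s x. kronecker (*) (\<phi> s) (\<psi> x)))))"


section \<open>Inductive limits\<close>

definition inductive_sequence :: "(nat \<Rightarrow> 'u opsys) \<Rightarrow> (nat \<Rightarrow> 'u \<Rightarrow> 'u) \<Rightarrow> bool" where
  "inductive_sequence S \<phi> \<longleftrightarrow>
     (\<forall>k. operator_system (S k)) \<and> (\<forall>k. ucp (S k) (S (Suc k)) (\<phi> k))"

definition cocone :: "(nat \<Rightarrow> 'u opsys) \<Rightarrow> (nat \<Rightarrow> 'u \<Rightarrow> 'u) \<Rightarrow> 'u opsys \<Rightarrow>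
    (nat \<Rightarrow> 'u \<Rightarrow> 'u) \<Rightarrow> bool" where
  "cocone S \<phi> R \<rho> \<longleftrightarrow>
     operator_system R \<and> (\<forall>k. ucp (S k) R (\<rho> k)) \<and>
     (\<forall>k. \<forall>x\<in>carrier (S k). \<rho> (Suc k) (\<phi> k x) = \<rho> k x)"

definition inductive_limit :: "(nat \<Rightarrow> 'u opsys) \<Rightarrow> (nat \<Rightarrow> 'u \<Rightarrow> 'u) \<Rightarrow> 'u opsys \<Rightarrow>
    (nat \<Rightarrow> 'u \<Rightarrow> 'u) \<Rightarrow> bool" where
  "inductive_limit S \<phi> L \<theta> \<longleftrightarrow>
     cocone S \<phi> L \<theta> \<and>
     (\<forall>R \<rho>. cocone S \<phi> R \<rho> \<longrightarrow>
        (\<exists>f. ucp L R f \<and> (\<forall>k. \<forall>x\<in>carrier (S k). f (\<theta> k x) = \<rho> k x) \<and>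
             (\<forall>g. ucp L R g \<and> (\<forall>k. \<forall>x\<in>carrier (S k). g (\<theta> k x) = \<rho> k x) \<longrightarrow>
                  (\<forall>y\<in>carrier L. g y = f y))))"

text \<open>
  The assertion that the inductive limit of \<open>(S, \<phi>)\<close> is canonically completely order isomorphic to
  \<open>Y\<close>: the sequence lies in the operator system category, it has an inductive limit, and each of its
  inductive limits is completely order isomorphic to \<open>Y\<close> by an isomorphism carrying the
  structure maps \<open>\<theta> k\<close> to the given maps \<open>\<eta> k\<close>.
\<close>

definition limit_canonically_iso :: "(nat \<Rightarrow> 'u opsys) \<Rightarrow> (nat \<Rightarrow> 'u \<Rightarrow> 'u) \<Rightarrow> 'u opsys \<Rightarrow>
    (nat \<Rightarrow> 'u \<Rightarrow> 'u) \<Rightarrow> bool" where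
  "limit_canonically_iso S \<phi> Y \<eta> \<longleftrightarrow>
     inductive_sequence S \<phi> \<and>
     (\<exists>L \<theta>. inductive_limit S \<phi> L \<theta>) \<and>
     (\<forall>L \<theta>. inductive_limit S \<phi> L \<theta> \<longrightarrow>
        (\<exists>\<Phi>. complete_order_iso L Y \<Phi> \<and> (\<forall>k. \<forall>x\<in>carrier (S k). \<Phi> (\<theta> k x) = \<eta> k x)))"

definition commutes_with_limits_in_first :: "'u tensor \<Rightarrow> bool" where
  "commutes_with_limits_in_first \<tau> \<longleftrightarrow>
     (\<forall>S \<phi> L \<theta> T. inductive_sequence S \<phi> \<and> inductive_limit S \<phi> L \<theta> \<and> operator_system T \<longrightarrow>
        limit_canonically_iso
          (\<lambda>k. tensor_sys \<tau> (S k) T) (\<lambda>k. tensor_map \<tau> (S k) T (S (Suc k)) T (\<phi> k) id)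
          (tensor_sys \<tau> L T) (\<lambda>k. tensor_map \<tau> (S k) T L T (\<theta> k) id))"

definition commutes_with_limits_in_second :: "'u tensor \<Rightarrow> bool" where
  "commutes_with_limits_in_second \<tau> \<longleftrightarrow>
     (\<forall>S \<phi> L \<theta> T. inductive_sequence S \<phi> \<and> inductive_limit S \<phi> L \<theta> \<and> operator_system T \<longrightarrow>
        limit_canonically_iso
          (\<lambda>k. tensor_sys \<tau> T (S k)) (\<lambda>k. tensor_map \<tau> T (S k) T (S (Suc k)) id (\<phi> k))
          (tensor_sys \<tau> T L) (\<lambda>k. tensor_map \<tau> T (S k) T L id (\<theta> k)))"

text \<open>
  A tensor product need not be symmetric, so commuting with inductive limits has to be required in
  both variables.  One variable does not suffice for the joint limit: the tensor product \<open>er\<close>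
  induced by the maximal tensor product with the injective envelope of the second factor commutes
  with inductive limits in the first variable, but not in the second.
\<close>

definition commutes_with_inductive_limits :: "'u tensor \<Rightarrow> bool" where
  "commutes_with_inductive_limits \<tau> \<longleftrightarrow>
     commutes_with_limits_in_first \<tau> \<and> commutes_with_limits_in_second \<tau>"

end

theory Submission
  imports Defs
begin

text \<open>
  The joint limit is obtained as an iterated one.  Write \<open>L\<close> and \<open>M\<close> for the limits of the two
  sequences.  Since \<open>\<tau>\<close> commutes with limits in the second variable, \<open>S\<^sub>k \<otimes> M\<close> is the limit over \<open>j\<close>
  of \<open>S\<^sub>k \<otimes> T\<^sub>j\<close>; since it does so in the first variable, \<open>L \<otimes> M\<close> is the limit over \<open>k\<close> of
  \<open>S\<^sub>k \<otimes> M\<close>.  Hence \<open>L \<otimes> M\<close> is universal for families of maps on all the \<open>S\<^sub>k \<otimes> T\<^sub>j\<close> that are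
  compatible in both indices.  Such a family is determined by its diagonal, and each cocone \<open>\<rho>\<close> on
  the diagonal extends to one: follow the connecting maps from \<open>S\<^sub>k \<otimes> T\<^sub>j\<close> to the diagonal entry
  with index \<open>max k j\<close>, then apply \<open>\<rho>\<close>.  So the diagonal sequence also has the limit \<open>L \<otimes> M\<close>
  (\<open>inductive_limit_diagonal\<close>), and limits are unique up to canonical isomorphism.

  The argument needs tensor products of u.c.p. maps to be u.c.p., which is not among the axioms of
  an operator system tensor product.  It follows from commutation with limits
  (\<open>ucp_tensor_map\<close>): a single u.c.p. map \<open>f\<close> from \<open>S\<close> to \<open>S'\<close> is the first map of the
  inductive sequence \<open>S, S', S', \<dots>\<close>, whose limit is \<open>S'\<close>, and the commutation hypothesis
  includes that the tensored sequence again consists of u.c.p. maps.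

  Equalities between maps are checked on elementary tensors, where everything reduces to
  the connecting maps of the two given sequences.
\<close>

section \<open>Linear and unital completely positive maps\<close>

lemma linear_maps_iff:
  "f \<in> linear_maps V W \<longleftrightarrow>
     (\<forall>x\<in>carrier V. f x \<in> carrier W) \<and>
     (\<forall>x\<in>carrier V. \<forall>y\<in>carrier V. f (x \<oplus>\<^bsub>V\<^esub> y) = f x \<oplus>\<^bsub>W\<^esub> f y) \<and>
     (\<forall>c. \<forall>x\<in>carrier V. f (c \<odot>\<^bsub>V\<^esub> x) = c \<odot>\<^bsub>W\<^esub> f x)"
  by (auto simp: LinearCombinations.module_hom_def class_field_def)

lemma linear_maps_closed:
  "f \<in> linear_maps V W \<Longrightarrow> x \<in> carrier V \<Longrightarrow> f x \<in> carrier W"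
  by (simp add: linear_maps_iff)

lemma linear_maps_comp:
  assumes "f \<in> linear_maps U V" "g \<in> linear_maps V W"
  shows "(\<lambda>x. g (f x)) \<in> linear_maps U W"
  using assms by (simp add: linear_maps_iff)

lemma operator_system_closed:
  assumes "operator_system S"
  shows "x \<in> carrier S \<Longrightarrow> y \<in> carrier S \<Longrightarrow> x \<oplus>\<^bsub>S\<^esub> y \<in> carrier S"
    and "x \<in> carrier S \<Longrightarrow> c \<odot>\<^bsub>S\<^esub> x \<in> carrier S"
    and "\<one>\<^bsub>S\<^esub> \<in> carrier S"
proof -
  interpret operator_system S by fact
  show "x \<in> carrier S \<Longrightarrow> y \<in> carrier S \<Longrightarrow> x \<oplus>\<^bsub>S\<^esub> y \<in> carrier S" by simp
  show "x \<in> carrier S \<Longrightarrow> c \<odot>\<^bsub>S\<^esub> x \<in> carrier S" by (simp add: class_field_def)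
  show "\<one>\<^bsub>S\<^esub> \<in> carrier S" by (rule unit_closed)
qed

lemma operator_system_pos_entries:
  assumes "operator_system S" "A \<in> pos S n" "x \<in> elements_mat A"
  shows "x \<in> carrier S"
proof -
  interpret operator_system S by fact
  show ?thesis
    using pos_hermitian[of n] assms(2,3) by (auto simp: hermitian_matrices_def matrices_def)
qed

lemma map_mat_cong_entries:
  "(\<And>x. x \<in> elements_mat A \<Longrightarrow> f x = g x) \<Longrightarrow> map_mat f A = map_mat g A"
  by (rule eq_matI) (auto intro: elements_matI[OF carrier_matI])

lemma ucp_closed: "ucp S T f \<Longrightarrow> x \<in> carrier S \<Longrightarrow> f x \<in> carrier T"
  by (auto simp: ucp_def linear_maps_closed)

text \<open>
  Positive matrices have their entries in the carrier, so the values of a map elsewhere do not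
  affect whether it is u.c.p.  This matters because induced maps and inverses are determined on
  carriers only.
\<close>

lemma ucp_cong:
  assumes S: "operator_system S" and f: "ucp S T f"
    and eq: "\<And>x. x \<in> carrier S \<Longrightarrow> g x = f x"
  shows "ucp S T g"
proof -
  have "map_mat g A = map_mat f A" if "A \<in> pos S n" for A n
    using operator_system_pos_entries[OF S that] eq by (intro map_mat_cong_entries) auto
  then show ?thesis
    using f eq operator_system_closed[OF S] by (auto simp: ucp_def linear_maps_iff)
qed

lemma ucp_id:
  fixes S :: "('a, 'm) opsys_scheme"
  shows "operator_system S \<Longrightarrow> ucp S S (\<lambda>x. x)"
proof -
  have "map_mat (\<lambda>x. x) A = A" for A :: "'a mat"
    by (rule eq_matI) auto
  then show "operator_system S \<Longrightarrow> ucp S S (\<lambda>x. x)"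
    by (simp add: ucp_def linear_maps_iff)
qed

lemma ucp_comp:
  assumes "ucp R S f" "ucp S T g"
  shows "ucp R T (\<lambda>x. g (f x))"
proof -
  have "map_mat (\<lambda>x. g (f x)) A = map_mat g (map_mat f A)" for A
    by (rule eq_matI) auto
  then show ?thesis
    using assms by (auto simp: ucp_def intro: linear_maps_comp)
qed


section \<open>Inductive limits up to isomorphism\<close>

lemma inductive_limit_factor:
  assumes "inductive_limit S \<phi> L \<theta>" "cocone S \<phi> R \<rho>"
  obtains f where "ucp L R f" "\<And>k x. x \<in> carrier (S k) \<Longrightarrow> f (\<theta> k x) = \<rho> k x"
    and "\<And>g y. ucp L R g \<Longrightarrow> (\<And>k x. x \<in> carrier (S k) \<Longrightarrow> g (\<theta> k x) = \<rho> k x) \<Longrightarrow>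
      y \<in> carrier L \<Longrightarrow> g y = f y"
proof -
  have "\<exists>f. ucp L R f \<and> (\<forall>k. \<forall>x\<in>carrier (S k). f (\<theta> k x) = \<rho> k x) \<and>
             (\<forall>g. ucp L R g \<and> (\<forall>k. \<forall>x\<in>carrier (S k). g (\<theta> k x) = \<rho> k x) \<longrightarrow>
                  (\<forall>y\<in>carrier L. g y = f y))"
    using assms by (simp add: inductive_limit_def)
  then show thesis
    using that by (elim exE conjE) blast
qed

lemma inductive_limit_map_eq:
  fixes S :: "nat \<Rightarrow> 'u opsys" and R :: "'u opsys"
  assumes L: "inductive_limit S \<phi> L \<theta>"
    and "operator_system R" "ucp L R f" "ucp L R g"
    and eq: "\<And>k x. x \<in> carrier (S k) \<Longrightarrow> f (\<theta> k x) = g (\<theta> k x)"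
    and y: "y \<in> carrier L"
  shows "f y = g y"
proof -
  have "cocone S \<phi> R (\<lambda>k x. f (\<theta> k x))"
    using L \<open>operator_system R\<close> \<open>ucp L R f\<close>
    by (auto simp: cocone_def inductive_limit_def intro: ucp_comp)
  then obtain h where h: "\<And>g y. ucp L R g \<Longrightarrow>
      (\<And>k x. x \<in> carrier (S k) \<Longrightarrow> g (\<theta> k x) = f (\<theta> k x)) \<Longrightarrow> y \<in> carrier L \<Longrightarrow> g y = h y"
    by (rule inductive_limit_factor[OF L]) blast
  have "f y = h y" using assms by (intro h) auto
  moreover have "g y = h y" using assms by (intro h) auto
  ultimately show ?thesis by simp
qed

text \<open>The usual argument: the two maps given by the universal properties are mutually inverse.\<close>

lemma inductive_limit_iso_unique:
  assumes L: "inductive_limit S \<phi> L \<theta>" and Y: "inductive_limit S \<phi> Y \<eta>"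
  shows "\<exists>\<Phi>. complete_order_iso L Y \<Phi> \<and> (\<forall>k. \<forall>x\<in>carrier (S k). \<Phi> (\<theta> k x) = \<eta> k x)"
proof -
  have cocones: "cocone S \<phi> L \<theta>" "cocone S \<phi> Y \<eta>"
    using L Y by (auto simp: inductive_limit_def)
  then have osL: "operator_system L" and osY: "operator_system Y"
    and \<theta>: "\<And>k. ucp (S k) L (\<theta> k)" and \<eta>: "\<And>k. ucp (S k) Y (\<eta> k)"
    by (auto simp: cocone_def)
  obtain f where f: "ucp L Y f" "\<And>k x. x \<in> carrier (S k) \<Longrightarrow> f (\<theta> k x) = \<eta> k x"
    by (rule inductive_limit_factor[OF L cocones(2)]) (rule that)
  obtain g where g: "ucp Y L g" "\<And>k x. x \<in> carrier (S k) \<Longrightarrow> g (\<eta> k x) = \<theta> k x"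
    by (rule inductive_limit_factor[OF Y cocones(1)]) (rule that)
  have gf: "g (f x) = x" if "x \<in> carrier L" for x
    using inductive_limit_map_eq[OF L osL ucp_comp[OF f(1) g(1)] ucp_id[OF osL] _ that]
    by (simp add: f g)
  have fg: "f (g y) = y" if "y \<in> carrier Y" for y
    using inductive_limit_map_eq[OF Y osY ucp_comp[OF g(1) f(1)] ucp_id[OF osY] _ that]
    by (simp add: f g)
  have bij: "bij_betw f (carrier L) (carrier Y)"
    by (rule bij_betw_byWitness[where f' = g]) (auto simp: gf fg ucp_closed[OF f(1)] ucp_closed[OF g(1)])
  have "inv_into (carrier L) f y = g y" if "y \<in> carrier Y" for y
    using bij that by (metis bij_betw_def fg g(1) inv_into_f_f ucp_closed)
  then have "ucp Y L (inv_into (carrier L) f)"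
    by (intro ucp_cong[OF osY g(1)])
  then show ?thesis
    using bij f by (auto simp: complete_order_iso_def)
qed

lemma limit_canonically_isoI:
  "inductive_sequence S \<phi> \<Longrightarrow> inductive_limit S \<phi> Y \<eta> \<Longrightarrow> limit_canonically_iso S \<phi> Y \<eta>"
  unfolding limit_canonically_iso_def using inductive_limit_iso_unique by blast

text \<open>
  Being a limit is transported along an isomorphism.  This turns the hypothesis of commuting with
  limits, which speaks of isomorphisms, into universal properties.
\<close>

lemma limit_canonically_iso_imp_inductive_limit:
  assumes iso: "limit_canonically_iso S \<phi> Y \<eta>" and Y: "operator_system Y"
  shows "inductive_limit S \<phi> Y \<eta>"
proof -
  obtain L \<theta> \<Phi> where L: "inductive_limit S \<phi> L \<theta>" and \<Phi>: "complete_order_iso L Y \<Phi>"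
    and \<Phi>\<theta>: "\<And>k x. x \<in> carrier (S k) \<Longrightarrow> \<Phi> (\<theta> k x) = \<eta> k x"
    using iso unfolding limit_canonically_iso_def by blast
  define \<Psi> where "\<Psi> = inv_into (carrier L) \<Phi>"
  have S: "operator_system (S k)" and \<phi>: "ucp (S k) (S (Suc k)) (\<phi> k)" for k
    using iso by (auto simp: limit_canonically_iso_def inductive_sequence_def)
  have \<theta>: "ucp (S k) L (\<theta> k)" for k
    using L by (auto simp: inductive_limit_def cocone_def)
  have bij: "bij_betw \<Phi> (carrier L) (carrier Y)" and u\<Phi>: "ucp L Y \<Phi>" and u\<Psi>: "ucp Y L \<Psi>"
    using \<Phi> by (auto simp: complete_order_iso_def \<Psi>_def)
  have \<Psi>\<Phi>: "\<Psi> (\<Phi> x) = x" if "x \<in> carrier L" for x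
    using bij that by (simp add: \<Psi>_def bij_betw_def)
  have \<Phi>\<Psi>: "\<Phi> (\<Psi> y) = y" if "y \<in> carrier Y" for y
    using bij that by (simp add: \<Psi>_def bij_betw_def f_inv_into_f)
  have \<Psi>\<eta>: "\<Psi> (\<eta> k x) = \<theta> k x" if "x \<in> carrier (S k)" for k x
    using \<Psi>\<Phi> \<Phi>\<theta> that ucp_closed[OF \<theta>] by metis
  have u\<eta>: "ucp (S k) Y (\<eta> k)" for k
    by (rule ucp_cong[OF S ucp_comp[OF \<theta> u\<Phi>]]) (simp add: \<Phi>\<theta>)
  have "cocone S \<phi> Y \<eta>"
    unfolding cocone_def
  proof (intro conjI allI ballI Y u\<eta>)
    fix k x assume x: "x \<in> carrier (S k)"
    have "\<theta> (Suc k) (\<phi> k x) = \<theta> k x"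
      using L x by (simp add: inductive_limit_def cocone_def)
    then show "\<eta> (Suc k) (\<phi> k x) = \<eta> k x"
      using \<Phi>\<theta>[OF x] \<Phi>\<theta>[OF ucp_closed[OF \<phi> x]] by simp
  qed
  moreover have "\<exists>f. ucp Y R f \<and> (\<forall>k. \<forall>x\<in>carrier (S k). f (\<eta> k x) = \<rho> k x) \<and>
             (\<forall>g. ucp Y R g \<and> (\<forall>k. \<forall>x\<in>carrier (S k). g (\<eta> k x) = \<rho> k x) \<longrightarrow>
                  (\<forall>y\<in>carrier Y. g y = f y))" if R: "cocone S \<phi> R \<rho>" for R \<rho>
  proof -
    obtain h where h: "ucp L R h" "\<And>k x. x \<in> carrier (S k) \<Longrightarrow> h (\<theta> k x) = \<rho> k x"
      by (rule inductive_limit_factor[OF L R]) (rule that)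
    have "g y = h (\<Psi> y)" if g: "ucp Y R g" "\<And>k x. x \<in> carrier (S k) \<Longrightarrow> g (\<eta> k x) = \<rho> k x"
      and y: "y \<in> carrier Y" for g y
    proof -
      have "operator_system R" using R by (simp add: cocone_def)
      then have "g (\<Phi> (\<Psi> y)) = h (\<Psi> y)"
        using inductive_limit_map_eq[OF L _ ucp_comp[OF u\<Phi> g(1)] h(1) _ ucp_closed[OF u\<Psi> y]]
        by (simp add: \<Phi>\<theta> g h)
      then show ?thesis by (simp add: \<Phi>\<Psi> y)
    qed
    then show ?thesis
      by (intro exI[of _ "\<lambda>y. h (\<Psi> y)"]) (auto simp: \<Psi>\<eta> h intro: ucp_comp[OF u\<Psi> h(1)])
  qed
  ultimately show ?thesis unfolding inductive_limit_def by blast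
qed


section \<open>Connecting maps over several steps\<close>

text \<open>
  For \<open>j \<le> n\<close> this is the composite connecting map from stage \<open>j\<close> to stage \<open>n\<close>; the interval
  \<open>[j..<n]\<close> makes it the identity for \<open>j = n\<close>.
\<close>

definition transition :: "(nat \<Rightarrow> 'u \<Rightarrow> 'u) \<Rightarrow> nat \<Rightarrow> nat \<Rightarrow> 'u \<Rightarrow> 'u" where
  "transition \<phi> j n = fold \<phi> [j..<n]"

lemma transition_refl [simp]: "transition \<phi> n n x = x"
  by (simp add: transition_def)

lemma transition_Suc: "j \<le> n \<Longrightarrow> transition \<phi> j (Suc n) x = \<phi> n (transition \<phi> j n x)"
  by (simp add: transition_def)

lemma transition_step: "j < n \<Longrightarrow> transition \<phi> (Suc j) n (\<phi> j x) = transition \<phi> j n x"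
  by (simp add: transition_def upt_conv_Cons)

lemma ucp_transition:
  assumes "inductive_sequence S \<phi>" "j \<le> n"
  shows "ucp (S j) (S n) (transition \<phi> j n)"
  using assms(2)
proof (induction n rule: dec_induct)
  case base
  then show ?case
    using assms(1) ucp_id by (auto simp: inductive_sequence_def transition_def id_def)
next
  case (step n)
  have "transition \<phi> j (Suc n) = (\<lambda>x. \<phi> n (transition \<phi> j n x))"
    using step by (auto simp: transition_Suc)
  then show ?case
    using step assms(1) by (auto simp: inductive_sequence_def intro: ucp_comp)
qed

lemma cocone_transition:
  assumes S: "inductive_sequence S \<phi>" and R: "cocone S \<phi> R \<rho>" and "j \<le> n"
    and x: "x \<in> carrier (S j)"
  shows "\<rho> n (transition \<phi> j n x) = \<rho> j x"
  using \<open>j \<le> n\<close>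
proof (induction n rule: dec_induct)
  case base
  then show ?case by simp
next
  case (step n)
  then show ?case
    using R ucp_closed[OF ucp_transition[OF S step(1)] x] by (simp add: transition_Suc cocone_def)
qed


section \<open>Maps out of a tensor product\<close>

text \<open>
  The universal property of the algebraic tensor product is tested on plain modules only.  Forgetting
  the additional fields of an operator system makes it applicable to operator systems.
\<close>

lemma vectorspace_truncate:
  assumes "operator_system R"
  shows "vectorspace (class_ring :: complex ring) (module.truncate R)"
proof -
  interpret operator_system R by fact
  have "abelian_group (module.truncate R)"
    by (rule abelian_groupI) (auto simp: module.truncate_def a_ac intro!: bexI[of _ "\<ominus>\<^bsub>R\<^esub> _"] l_neg)
  then have "Module.module (class_ring :: complex ring) (module.truncate R)"
    using module_axioms[unfolded Module.module_def] smult_closed smult_l_distr smult_r_distr smult_assoc1 smult_one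
    by (intro moduleI) (auto simp: module.truncate_def class_field_def)
  then show ?thesis
    using vectorspace_axioms by (simp add: vectorspace_def)
qed

lemma linear_maps_truncate: "linear_maps V (module.truncate W) = linear_maps V W"
  by (auto simp: linear_maps_iff module.truncate_def)

lemma bilinear_map_truncate: "bilinear_map S T (module.truncate W) b = bilinear_map S T W b"
  by (simp add: bilinear_map_def linear_maps_truncate)

lemma bilinear_map_closed:
  assumes "bilinear_map S T W b" "s \<in> carrier S" "x \<in> carrier T"
  shows "b s x \<in> carrier W"
proof -
  have "b s \<in> linear_maps T W"
    using assms by (simp add: bilinear_map_def)
  then show ?thesis
    using assms(3) by (rule linear_maps_closed)
qed

lemma bilinear_map_pre:
  assumes b: "bilinear_map S' T' W b" and f: "f \<in> linear_maps S S'" and g: "g \<in> linear_maps T T'"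
  shows "bilinear_map S T W (\<lambda>s x. b (f s) (g x))"
  unfolding bilinear_map_def
proof (intro conjI ballI)
  fix s assume "s \<in> carrier S"
  then have "b (f s) \<in> linear_maps T' W"
    using b linear_maps_closed[OF f] by (simp add: bilinear_map_def)
  then show "(\<lambda>x. b (f s) (g x)) \<in> linear_maps T W"
    by (rule linear_maps_comp[OF g])
next
  fix x assume "x \<in> carrier T"
  then have "(\<lambda>s. b s (g x)) \<in> linear_maps S' W"
    using b linear_maps_closed[OF g] by (simp add: bilinear_map_def)
  then show "(\<lambda>s. b (f s) (g x)) \<in> linear_maps S W"
    by (rule linear_maps_comp[OF f])
qed

lemma bilinear_map_post:
  assumes b: "bilinear_map S T V b" and f: "f \<in> linear_maps V W"
  shows "bilinear_map S T W (\<lambda>s x. f (b s x))"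
  unfolding bilinear_map_def
proof (intro conjI ballI)
  fix s assume "s \<in> carrier S"
  then have "b s \<in> linear_maps T V"
    using b by (simp add: bilinear_map_def)
  then show "(\<lambda>x. f (b s x)) \<in> linear_maps T W"
    using f by (rule linear_maps_comp)
next
  fix x assume "x \<in> carrier T"
  then have "(\<lambda>s. b s x) \<in> linear_maps S V"
    using b by (simp add: bilinear_map_def)
  then show "(\<lambda>s. f (b s x)) \<in> linear_maps S W"
    using f by (rule linear_maps_comp)
qed

lemma algebraic_tensor_productD:
  fixes S :: "(complex, 'u, 'k) module_scheme" and T :: "(complex, 'u, 'l) module_scheme"
    and V :: "(complex, 'u, 'm) module_scheme" and W :: "(complex, 'u) module"
  assumes "algebraic_tensor_product S T V t" "vectorspace (class_ring :: complex ring) W"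
    and "bilinear_map S T W b"
  shows "\<exists>f\<in>linear_maps V W.
           (\<forall>s\<in>carrier S. \<forall>x\<in>carrier T. f (t s x) = b s x) \<and>
           (\<forall>g\<in>linear_maps V W.
              (\<forall>s\<in>carrier S. \<forall>x\<in>carrier T. g (t s x) = b s x) \<longrightarrow>
              (\<forall>v\<in>carrier V. g v = f v))"
  using assms by (simp add: algebraic_tensor_product_def)

lemma induced_map_works:
  fixes S :: "(complex, 'u, 'k) module_scheme" and T :: "(complex, 'u, 'l) module_scheme"
    and V :: "(complex, 'u, 'm) module_scheme" and W :: "('u, 'n) opsys_scheme"
  assumes V: "algebraic_tensor_product S T V t" and W: "operator_system W" "bilinear_map S T W b"
  shows "induced_map S T V t W b \<in> linear_maps V W"
    and "s \<in> carrier S \<Longrightarrow> x \<in> carrier T \<Longrightarrow> induced_map S T V t W b (t s x) = b s x"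
proof -
  have "\<exists>f\<in>linear_maps V W. \<forall>s\<in>carrier S. \<forall>x\<in>carrier T. f (t s x) = b s x"
    using algebraic_tensor_productD[OF V vectorspace_truncate[OF W(1)], of b] W(2)
    unfolding linear_maps_truncate bilinear_map_truncate by blast
  then have "\<exists>f. f \<in> linear_maps V W \<and> (\<forall>s\<in>carrier S. \<forall>x\<in>carrier T. f (t s x) = b s x)"
    by blast
  note this' = someI_ex[OF this, folded induced_map_def]
  show "induced_map S T V t W b \<in> linear_maps V W"
    and "s \<in> carrier S \<Longrightarrow> x \<in> carrier T \<Longrightarrow> induced_map S T V t W b (t s x) = b s x"
    using this' by auto
qed

lemma linear_map_eq_on_tensors:
  fixes S :: "(complex, 'u, 'k) module_scheme" and T :: "(complex, 'u, 'l) module_scheme"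
    and V :: "(complex, 'u, 'm) module_scheme" and R :: "('u, 'n) opsys_scheme"
  assumes V: "algebraic_tensor_product S T V t" and R: "operator_system R"
    and f: "f \<in> linear_maps V R" and g: "g \<in> linear_maps V R"
    and eq: "\<And>s x. s \<in> carrier S \<Longrightarrow> x \<in> carrier T \<Longrightarrow> f (t s x) = g (t s x)"
    and v: "v \<in> carrier V"
  shows "f v = g v"
proof -
  let ?W = "module.truncate R"
  have "bilinear_map S T ?W (\<lambda>s x. f (t s x))"
    using V f bilinear_map_post[of S T V t f R]
    by (simp add: algebraic_tensor_product_def bilinear_map_truncate)
  from algebraic_tensor_productD[OF V vectorspace_truncate[OF R] this]
  obtain h where h: "\<forall>g\<in>linear_maps V ?W.
      (\<forall>s\<in>carrier S. \<forall>x\<in>carrier T. g (t s x) = f (t s x)) \<longrightarrow> (\<forall>v\<in>carrier V. g v = h v)"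
    by blast
  have "f v = h v"
    using h f v by (simp add: linear_maps_truncate)
  moreover have "g v = h v"
    using h[rule_format, of g] g v eq by (simp add: linear_maps_truncate)
  ultimately show ?thesis by simp
qed


section \<open>Functoriality\<close>

locale os_tensor =
  fixes \<tau> :: "'u tensor"
  assumes tensor: "operator_system_tensor_product \<tau>"
begin

lemma
  assumes "operator_system S" "operator_system T"
  shows tensor_sys: "operator_system (tensor_sys \<tau> S T)"
    and algebraic_tensor: "algebraic_tensor_product S T (tensor_sys \<tau> S T) (elem_tensor \<tau> S T)"
proof -
  note * = tensor[unfolded operator_system_tensor_product_def, THEN spec, THEN spec, THEN mp,
      OF conjI[OF assms]]
  show "operator_system (tensor_sys \<tau> S T)"
    by (rule *[THEN conjunct1])
  show "algebraic_tensor_product S T (tensor_sys \<tau> S T) (elem_tensor \<tau> S T)"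
    by (rule *[THEN conjunct2, THEN conjunct1])
qed

lemma bilinear_elem_tensor:
  assumes "operator_system S" "operator_system T"
  shows "bilinear_map S T (tensor_sys \<tau> S T) (elem_tensor \<tau> S T)"
  by (rule algebraic_tensor[OF assms, unfolded algebraic_tensor_product_def, THEN conjunct2, THEN conjunct1])

lemma elem_tensor_closed:
  "operator_system S \<Longrightarrow> operator_system T \<Longrightarrow> s \<in> carrier S \<Longrightarrow> x \<in> carrier T \<Longrightarrow>
    elem_tensor \<tau> S T s x \<in> carrier (tensor_sys \<tau> S T)"
  by (rule bilinear_map_closed[OF bilinear_elem_tensor])

lemma tensor_map_linear_elem:
  assumes os: "operator_system S" "operator_system T" "operator_system S'" "operator_system T'"
    and f: "ucp S S' f" and g: "ucp T T' g"
  shows tensor_map_linear: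
      "tensor_map \<tau> S T S' T' f g \<in> linear_maps (tensor_sys \<tau> S T) (tensor_sys \<tau> S' T')"
    and tensor_map_elem: "s \<in> carrier S \<Longrightarrow> x \<in> carrier T \<Longrightarrow>
      tensor_map \<tau> S T S' T' f g (elem_tensor \<tau> S T s x) = elem_tensor \<tau> S' T' (f s) (g x)"
proof -
  have "f \<in> linear_maps S S'" "g \<in> linear_maps T T'"
    using f g by (auto simp: ucp_def)
  then have b: "bilinear_map S T (tensor_sys \<tau> S' T') (\<lambda>s x. elem_tensor \<tau> S' T' (f s) (g x))"
    by (rule bilinear_map_pre[OF bilinear_elem_tensor[OF os(3,4)]])
  note works = induced_map_works[OF algebraic_tensor[OF os(1,2)] tensor_sys[OF os(3,4)] b]
  show "tensor_map \<tau> S T S' T' f g \<in> linear_maps (tensor_sys \<tau> S T) (tensor_sys \<tau> S' T')"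
    unfolding tensor_map_def by (rule works(1))
  show "tensor_map \<tau> S T S' T' f g (elem_tensor \<tau> S T s x) = elem_tensor \<tau> S' T' (f s) (g x)"
    if "s \<in> carrier S" "x \<in> carrier T"
    unfolding tensor_map_def using that by (rule works(2))
qed

lemma ucp_eq_on_tensors:
  fixes R :: "'u opsys"
  assumes os: "operator_system S" "operator_system T" "operator_system R"
    and f: "ucp (tensor_sys \<tau> S T) R f" and g: "ucp (tensor_sys \<tau> S T) R g"
    and eq: "\<And>s x. s \<in> carrier S \<Longrightarrow> x \<in> carrier T \<Longrightarrow>
      f (elem_tensor \<tau> S T s x) = g (elem_tensor \<tau> S T s x)"
    and v: "v \<in> carrier (tensor_sys \<tau> S T)"
  shows "f v = g v"
proof -
  have "f \<in> linear_maps (tensor_sys \<tau> S T) R" "g \<in> linear_maps (tensor_sys \<tau> S T) R"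
    using f g by (auto simp: ucp_def)
  then show ?thesis
    using eq v by (rule linear_map_eq_on_tensors[OF algebraic_tensor[OF os(1,2)] os(3)])
qed

end

text \<open>
  A u.c.p. map, viewed as the first step of a sequence that is constant afterwards.  The
  structure maps of the limit are the connecting maps themselves.
\<close>

lemma inductive_limit_eventually_constant:
  assumes S: "operator_system S" and S': "operator_system S'" and f: "ucp S S' f"
  defines "D \<equiv> \<lambda>k::nat. if k = 0 then S else S'"
    and "d \<equiv> \<lambda>k::nat. if k = 0 then f else (\<lambda>x. x)"
  shows "inductive_sequence D d" and "inductive_limit D d S' d"
proof -
  show "inductive_sequence D d"
    using S S' f ucp_id[OF S'] by (auto simp: inductive_sequence_def D_def d_def)
  have cc: "cocone D d S' d"
    using S' f ucp_id[OF S'] by (auto simp: cocone_def D_def d_def)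
  show "inductive_limit D d S' d"
    unfolding inductive_limit_def
  proof (intro conjI allI impI)
    fix R \<rho> assume R: "cocone D d R \<rho>"
    have "ucp (D k) R (\<rho> k)" for k
      using R by (simp add: cocone_def)
    from this[of 1] have u: "ucp S' R (\<rho> 1)"
      by (simp add: D_def)
    have step: "\<rho> (Suc k) (d k x) = \<rho> k x" if "x \<in> carrier (D k)" for k x
      using R that by (simp add: cocone_def)
    have const: "\<rho> (Suc k) x = \<rho> 1 x" if "x \<in> carrier S'" for k x
    proof (induction k)
      case (Suc k)
      then show ?case using step[of x "Suc k"] that by (simp add: D_def d_def)
    qed simp
    have "\<rho> 1 (d k x) = \<rho> k x" if x: "x \<in> carrier (D k)" for k x
    proof (cases k)
      case 0
      then show ?thesis using step[OF x] by simp
    next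
      case (Suc m)
      then show ?thesis using const[of x m] x by (simp add: D_def d_def)
    qed
    moreover have "g y = \<rho> 1 y" if g: "\<forall>k. \<forall>x\<in>carrier (D k). g (d k x) = \<rho> k x"
      and y: "y \<in> carrier S'" for g y
      using g[rule_format, of y 1] y by (simp add: D_def d_def)
    ultimately show "\<exists>f. ucp S' R f \<and> (\<forall>k. \<forall>x\<in>carrier (D k). f (d k x) = \<rho> k x) \<and>
             (\<forall>g. ucp S' R g \<and> (\<forall>k. \<forall>x\<in>carrier (D k). g (d k x) = \<rho> k x) \<longrightarrow>
                  (\<forall>y\<in>carrier S'. g y = f y))"
      using u by blast
  qed (rule cc)
qed

locale continuous_os_tensor = os_tensor \<tau> for \<tau> :: "'u tensor" +
  assumes commutes: "commutes_with_inductive_limits \<tau>"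
begin

lemma limit_first:
  assumes "inductive_sequence S \<phi>" "inductive_limit S \<phi> L \<theta>" "operator_system T"
  shows "inductive_sequence (\<lambda>k. tensor_sys \<tau> (S k) T) (\<lambda>k. tensor_map \<tau> (S k) T (S (Suc k)) T (\<phi> k) id)"
    and "inductive_limit (\<lambda>k. tensor_sys \<tau> (S k) T) (\<lambda>k. tensor_map \<tau> (S k) T (S (Suc k)) T (\<phi> k) id)
          (tensor_sys \<tau> L T) (\<lambda>k. tensor_map \<tau> (S k) T L T (\<theta> k) id)"
proof -
  have *: "limit_canonically_iso
          (\<lambda>k. tensor_sys \<tau> (S k) T) (\<lambda>k. tensor_map \<tau> (S k) T (S (Suc k)) T (\<phi> k) id)
          (tensor_sys \<tau> L T) (\<lambda>k. tensor_map \<tau> (S k) T L T (\<theta> k) id)"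
    using commutes assms
    by (simp add: commutes_with_inductive_limits_def commutes_with_limits_in_first_def)
  have "operator_system L"
    using assms by (simp add: inductive_limit_def cocone_def)
  then show "inductive_limit (\<lambda>k. tensor_sys \<tau> (S k) T) (\<lambda>k. tensor_map \<tau> (S k) T (S (Suc k)) T (\<phi> k) id)
          (tensor_sys \<tau> L T) (\<lambda>k. tensor_map \<tau> (S k) T L T (\<theta> k) id)"
    using assms by (intro limit_canonically_iso_imp_inductive_limit[OF *] tensor_sys)
  show "inductive_sequence (\<lambda>k. tensor_sys \<tau> (S k) T) (\<lambda>k. tensor_map \<tau> (S k) T (S (Suc k)) T (\<phi> k) id)"
    using * by (simp add: limit_canonically_iso_def)
qed

lemma limit_second:
  assumes "inductive_sequence S \<phi>" "inductive_limit S \<phi> L \<theta>" "operator_system T"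
  shows "inductive_sequence (\<lambda>k. tensor_sys \<tau> T (S k)) (\<lambda>k. tensor_map \<tau> T (S k) T (S (Suc k)) id (\<phi> k))"
    and "inductive_limit (\<lambda>k. tensor_sys \<tau> T (S k)) (\<lambda>k. tensor_map \<tau> T (S k) T (S (Suc k)) id (\<phi> k))
          (tensor_sys \<tau> T L) (\<lambda>k. tensor_map \<tau> T (S k) T L id (\<theta> k))"
proof -
  have *: "limit_canonically_iso
          (\<lambda>k. tensor_sys \<tau> T (S k)) (\<lambda>k. tensor_map \<tau> T (S k) T (S (Suc k)) id (\<phi> k))
          (tensor_sys \<tau> T L) (\<lambda>k. tensor_map \<tau> T (S k) T L id (\<theta> k))"
    using commutes assms
    by (simp add: commutes_with_inductive_limits_def commutes_with_limits_in_second_def)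
  have "operator_system L"
    using assms by (simp add: inductive_limit_def cocone_def)
  then show "inductive_limit (\<lambda>k. tensor_sys \<tau> T (S k)) (\<lambda>k. tensor_map \<tau> T (S k) T (S (Suc k)) id (\<phi> k))
          (tensor_sys \<tau> T L) (\<lambda>k. tensor_map \<tau> T (S k) T L id (\<theta> k))"
    using assms by (intro limit_canonically_iso_imp_inductive_limit[OF *] tensor_sys)
  show "inductive_sequence (\<lambda>k. tensor_sys \<tau> T (S k)) (\<lambda>k. tensor_map \<tau> T (S k) T (S (Suc k)) id (\<phi> k))"
    using * by (simp add: limit_canonically_iso_def)
qed

text \<open>
  Functoriality is proved one variable at a time, from the sequences \<open>S, S', S', \<dots>\<close> and
  \<open>T, T', T', \<dots>\<close>; then \<open>f \<otimes> g\<close> is the composite of \<open>f \<otimes> id\<close> and \<open>id \<otimes> g\<close>.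
\<close>

lemma ucp_tensor_map:
  assumes S: "operator_system S" and S': "operator_system S'"
    and T: "operator_system T" and T': "operator_system T'"
    and f: "ucp S S' f" and g: "ucp T T' g"
  shows "ucp (tensor_sys \<tau> S T) (tensor_sys \<tau> S' T') (tensor_map \<tau> S T S' T' f g)"
proof -
  have id: "ucp R R id" if "operator_system R" for R :: "'u opsys"
    using ucp_id[OF that] by (simp add: id_def)
  have f1: "ucp (tensor_sys \<tau> S T) (tensor_sys \<tau> S' T) (tensor_map \<tau> S T S' T f id)"
    using limit_first(1)[OF inductive_limit_eventually_constant[OF S S' f] T,
        unfolded inductive_sequence_def, THEN conjunct2, rule_format, of 0]
    by simp
  have g1: "ucp (tensor_sys \<tau> S' T) (tensor_sys \<tau> S' T') (tensor_map \<tau> S' T S' T' id g)"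
    using limit_second(1)[OF inductive_limit_eventually_constant[OF T T' g] S',
        unfolded inductive_sequence_def, THEN conjunct2, rule_format, of 0]
    by simp
  note lin = tensor_map_linear[OF S T S' T' f g]
  have lin': "(\<lambda>v. tensor_map \<tau> S' T S' T' id g (tensor_map \<tau> S T S' T f id v))
      \<in> linear_maps (tensor_sys \<tau> S T) (tensor_sys \<tau> S' T')"
    using ucp_comp[OF f1 g1] by (simp add: ucp_def)
  show ?thesis
  proof (rule ucp_cong[OF tensor_sys[OF S T] ucp_comp[OF f1 g1]])
    fix v assume "v \<in> carrier (tensor_sys \<tau> S T)"
    then show "tensor_map \<tau> S T S' T' f g v = tensor_map \<tau> S' T S' T' id g (tensor_map \<tau> S T S' T f id v)"
    proof (rule linear_map_eq_on_tensors[OF algebraic_tensor[OF S T] tensor_sys[OF S' T'] lin lin', rotated])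
      fix s x assume s: "s \<in> carrier S" and x: "x \<in> carrier T"
      show "tensor_map \<tau> S T S' T' f g (elem_tensor \<tau> S T s x) =
          tensor_map \<tau> S' T S' T' id g (tensor_map \<tau> S T S' T f id (elem_tensor \<tau> S T s x))"
        by (simp add: tensor_map_elem[OF S T S' T' f g s x] tensor_map_elem[OF S T S' T f id[OF T] s x]
            tensor_map_elem[OF S' T S' T' id[OF S'] g ucp_closed[OF f s] x])
    qed
  qed
qed

end


section \<open>The limit of a double sequence\<close>

locale double_sequence = continuous_os_tensor \<tau> for \<tau> :: "'u tensor" +
  fixes S T :: "nat \<Rightarrow> 'u opsys" and \<phi> \<psi> :: "nat \<Rightarrow> 'u \<Rightarrow> 'u"
    and L M :: "'u opsys" and \<theta> \<eta> :: "nat \<Rightarrow> 'u \<Rightarrow> 'u"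
  assumes S: "inductive_sequence S \<phi>" and L: "inductive_limit S \<phi> L \<theta>"
    and T: "inductive_sequence T \<psi>" and M: "inductive_limit T \<psi> M \<eta>"
begin

lemma operator_systems [simp]:
  "operator_system (S k)" "operator_system (T k)" "operator_system L" "operator_system M"
  using S T L M by (auto simp: inductive_sequence_def inductive_limit_def cocone_def)

lemma ucp_structure_maps [simp]:
  "ucp (S k) (S (Suc k)) (\<phi> k)" "ucp (T k) (T (Suc k)) (\<psi> k)"
  "ucp (S k) L (\<theta> k)" "ucp (T k) M (\<eta> k)"
  using S T L M by (auto simp: inductive_sequence_def inductive_limit_def cocone_def)

lemma ucp_id' [simp]: "operator_system R \<Longrightarrow> ucp R R id"
  using ucp_id[of R] by (simp add: id_def)

declare tensor_sys [simp]

lemma cocones: "cocone S \<phi> L \<theta>" "cocone T \<psi> M \<eta>"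
  using L M by (auto simp: inductive_limit_def)

lemma limit_step [simp]:
  "s \<in> carrier (S k) \<Longrightarrow> \<theta> (Suc k) (\<phi> k s) = \<theta> k s"
  "x \<in> carrier (T k) \<Longrightarrow> \<eta> (Suc k) (\<psi> k x) = \<eta> k x"
  using cocones by (auto simp: cocone_def)

abbreviation "diag k \<equiv> tensor_sys \<tau> (S k) (T k)"
abbreviation "diag_map k \<equiv> tensor_map \<tau> (S k) (T k) (S (Suc k)) (T (Suc k)) (\<phi> k) (\<psi> k)"
abbreviation "diag_lim k \<equiv> tensor_map \<tau> (S k) (T k) L M (\<theta> k) (\<eta> k)"
abbreviation "to_diag k j \<equiv> tensor_map \<tau> (S k) (T j) (S (max k j)) (T (max k j))
  (transition \<phi> k (max k j)) (transition \<psi> j (max k j))"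

lemma structure_maps_closed [simp]:
  "s \<in> carrier (S k) \<Longrightarrow> \<phi> k s \<in> carrier (S (Suc k))"
  "x \<in> carrier (T k) \<Longrightarrow> \<psi> k x \<in> carrier (T (Suc k))"
  "s \<in> carrier (S k) \<Longrightarrow> \<theta> k s \<in> carrier L"
  "x \<in> carrier (T k) \<Longrightarrow> \<eta> k x \<in> carrier M"
  "k \<le> n \<Longrightarrow> s \<in> carrier (S k) \<Longrightarrow> transition \<phi> k n s \<in> carrier (S n)"
  "k \<le> n \<Longrightarrow> x \<in> carrier (T k) \<Longrightarrow> transition \<psi> k n x \<in> carrier (T n)"
  by (auto intro: ucp_structure_maps[THEN ucp_closed]
      ucp_closed[OF ucp_transition[OF S]] ucp_closed[OF ucp_transition[OF T]])

lemma inductive_sequence_diagonal: "inductive_sequence diag diag_map"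
  by (simp add: inductive_sequence_def ucp_tensor_map)

lemma cocone_diag_lim: "cocone diag diag_map (tensor_sys \<tau> L M) diag_lim"
  unfolding cocone_def
proof (intro conjI allI ballI)
  fix k v assume v: "v \<in> carrier (diag k)"
  show "diag_lim (Suc k) (diag_map k v) = diag_lim k v"
    by (rule ucp_eq_on_tensors[OF _ _ _ ucp_comp[OF ucp_tensor_map ucp_tensor_map] ucp_tensor_map _ v])
       (simp_all add: tensor_map_elem)
qed (simp_all add: ucp_tensor_map)

text \<open>
  A cocone on the diagonal may be evaluated on \<open>S\<^sub>k \<otimes> T\<^sub>j\<close> through any diagonal entry beyond both
  indices.  Freedom in the choice of \<open>n\<close> makes the extended family compatible in both indices.
\<close>

lemma cocone_on_elem:
  assumes R: "cocone diag diag_map R \<rho>" and "k \<le> n" "j \<le> n"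
    and s: "s \<in> carrier (S k)" and x: "x \<in> carrier (T j)"
  shows "\<rho> (max k j) (to_diag k j (elem_tensor \<tau> (S k) (T j) s x)) =
    \<rho> n (elem_tensor \<tau> (S n) (T n) (transition \<phi> k n s) (transition \<psi> j n x))"
proof -
  have "max k j \<le> n" using assms by simp
  then show ?thesis
  proof (induction n rule: dec_induct)
    case base
    show ?case by (simp add: tensor_map_elem ucp_transition[OF S] ucp_transition[OF T] s x)
  next
    case (step n)
    have le: "k \<le> n" "j \<le> n" using step by auto
    let ?e = "elem_tensor \<tau> (S n) (T n) (transition \<phi> k n s) (transition \<psi> j n x)"
    have "\<rho> (Suc n) (diag_map n ?e) = \<rho> n ?e"
      using R le s x by (simp add: cocone_def elem_tensor_closed)
    then show ?case
      using step.IH le s x by (simp add: tensor_map_elem transition_Suc)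
  qed
qed

lemma inductive_limit_diagonal: "inductive_limit diag diag_map (tensor_sys \<tau> L M) diag_lim"
proof -
  have "\<exists>f. ucp (tensor_sys \<tau> L M) R f \<and> (\<forall>k. \<forall>v\<in>carrier (diag k). f (diag_lim k v) = \<rho> k v) \<and>
      (\<forall>g. ucp (tensor_sys \<tau> L M) R g \<and> (\<forall>k. \<forall>v\<in>carrier (diag k). g (diag_lim k v) = \<rho> k v) \<longrightarrow>
           (\<forall>y\<in>carrier (tensor_sys \<tau> L M). g y = f y))"
    if R: "cocone diag diag_map R \<rho>" for R \<rho>
  proof -
    have osR [simp]: "operator_system R" and u\<rho> [simp]: "\<And>k. ucp (diag k) R (\<rho> k)"
      using R by (auto simp: cocone_def)
    \<comment> \<open>The extension of \<open>\<rho>\<close> to a cocone over all pairs of indices.\<close>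
    define \<rho>' where "\<rho>' k j v = \<rho> (max k j) (to_diag k j v)" for k j v
    have u\<rho>': "ucp (tensor_sys \<tau> (S k) (T j)) R (\<rho>' k j)" for k j
      unfolding \<rho>'_def
      by (rule ucp_comp[OF ucp_tensor_map u\<rho>]) (simp_all add: ucp_transition[OF S] ucp_transition[OF T])
    have \<rho>'_elem: "\<rho>' k j (elem_tensor \<tau> (S k) (T j) s x) =
        \<rho> n (elem_tensor \<tau> (S n) (T n) (transition \<phi> k n s) (transition \<psi> j n x))"
      if "k \<le> n" "j \<le> n" "s \<in> carrier (S k)" "x \<in> carrier (T j)" for k j n s x
      unfolding \<rho>'_def by (rule cocone_on_elem[OF R that])
    have \<rho>'_step1: "\<rho>' (Suc k) j (elem_tensor \<tau> (S (Suc k)) (T j) (\<phi> k s) x) =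
        \<rho>' k j (elem_tensor \<tau> (S k) (T j) s x)"
      if "s \<in> carrier (S k)" "x \<in> carrier (T j)" for k j s x
      using that by (simp add: \<rho>'_elem[where n = "max (Suc k) j"] transition_step)
    have \<rho>'_step2: "\<rho>' k (Suc j) (elem_tensor \<tau> (S k) (T (Suc j)) s (\<psi> j x)) =
        \<rho>' k j (elem_tensor \<tau> (S k) (T j) s x)"
      if "s \<in> carrier (S k)" "x \<in> carrier (T j)" for k j s x
      using that by (simp add: \<rho>'_elem[where n = "max k (Suc j)"] transition_step)

    note row = limit_second(2)[OF T M operator_systems(1)]
    note col = limit_first(2)[OF S L operator_systems(4)]
    \<comment> \<open>Limit over \<open>j\<close>: for each \<open>k\<close> a map \<open>\<sigma> k\<close> on the tensor product of \<open>S k\<close> with \<open>M\<close>.\<close>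
    have "cocone (\<lambda>j. tensor_sys \<tau> (S k) (T j))
        (\<lambda>j. tensor_map \<tau> (S k) (T j) (S k) (T (Suc j)) id (\<psi> j)) R (\<rho>' k)" for k
      unfolding cocone_def
    proof (intro conjI allI ballI)
      fix j v assume v: "v \<in> carrier (tensor_sys \<tau> (S k) (T j))"
      show "\<rho>' k (Suc j) (tensor_map \<tau> (S k) (T j) (S k) (T (Suc j)) id (\<psi> j) v) = \<rho>' k j v"
        by (rule ucp_eq_on_tensors[OF _ _ _ ucp_comp[OF ucp_tensor_map u\<rho>'] u\<rho>' _ v])
           (simp_all add: tensor_map_elem \<rho>'_step2)
    qed (simp_all add: u\<rho>')
    then have "\<exists>\<sigma>. ucp (tensor_sys \<tau> (S k) M) R \<sigma> \<and>
        (\<forall>j. \<forall>v\<in>carrier (tensor_sys \<tau> (S k) (T j)).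
          \<sigma> (tensor_map \<tau> (S k) (T j) (S k) M id (\<eta> j) v) = \<rho>' k j v)" for k
      by (blast intro: inductive_limit_factor[OF row])
    then obtain \<sigma> where u\<sigma>: "\<And>k. ucp (tensor_sys \<tau> (S k) M) R (\<sigma> k)"
      and \<sigma>: "\<And>k j v. v \<in> carrier (tensor_sys \<tau> (S k) (T j)) \<Longrightarrow>
          \<sigma> k (tensor_map \<tau> (S k) (T j) (S k) M id (\<eta> j) v) = \<rho>' k j v"
      by metis
    have \<sigma>_elem: "\<sigma> k (elem_tensor \<tau> (S k) M s (\<eta> j x)) = \<rho>' k j (elem_tensor \<tau> (S k) (T j) s x)"
      if "s \<in> carrier (S k)" "x \<in> carrier (T j)" for k j s x
      using \<sigma>[OF elem_tensor_closed[OF _ _ that]] that by (simp add: tensor_map_elem)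
    \<comment> \<open>Maps out of a row limit are compared on tensors whose second leg comes from some \<open>T j\<close>.\<close>
    have row_eq: "f v = g v"
      if fg: "ucp (tensor_sys \<tau> (S k) M) R f" "ucp (tensor_sys \<tau> (S k) M) R g"
        and eq: "\<And>s j x. s \<in> carrier (S k) \<Longrightarrow> x \<in> carrier (T j) \<Longrightarrow>
          f (elem_tensor \<tau> (S k) M s (\<eta> j x)) = g (elem_tensor \<tau> (S k) M s (\<eta> j x))"
        and v: "v \<in> carrier (tensor_sys \<tau> (S k) M)" for k f g v
    proof (rule inductive_limit_map_eq[OF row osR fg _ v])
      fix j w assume w: "w \<in> carrier (tensor_sys \<tau> (S k) (T j))"
      show "f (tensor_map \<tau> (S k) (T j) (S k) M id (\<eta> j) w) =
          g (tensor_map \<tau> (S k) (T j) (S k) M id (\<eta> j) w)"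
        by (rule ucp_eq_on_tensors[OF _ _ _ ucp_comp[OF ucp_tensor_map fg(1)]
              ucp_comp[OF ucp_tensor_map fg(2)] _ w])
           (simp_all add: tensor_map_elem eq)
    qed
    \<comment> \<open>Limit over \<open>k\<close>: the maps \<open>\<sigma> k\<close> are compatible and factor through the tensor product of
      \<open>L\<close> and \<open>M\<close>.\<close>
    have "cocone (\<lambda>k. tensor_sys \<tau> (S k) M)
        (\<lambda>k. tensor_map \<tau> (S k) M (S (Suc k)) M (\<phi> k) id) R \<sigma>"
      unfolding cocone_def
    proof (intro conjI allI ballI)
      fix k v assume v: "v \<in> carrier (tensor_sys \<tau> (S k) M)"
      show "\<sigma> (Suc k) (tensor_map \<tau> (S k) M (S (Suc k)) M (\<phi> k) id v) = \<sigma> k v"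
        by (rule row_eq[OF ucp_comp[OF ucp_tensor_map u\<sigma>] u\<sigma> _ v])
           (simp_all add: tensor_map_elem \<sigma>_elem \<rho>'_step1)
    qed (simp_all add: u\<sigma>)
    then obtain f where uf: "ucp (tensor_sys \<tau> L M) R f"
      and f: "\<And>k v. v \<in> carrier (tensor_sys \<tau> (S k) M) \<Longrightarrow>
        f (tensor_map \<tau> (S k) M L M (\<theta> k) id v) = \<sigma> k v"
      by (rule inductive_limit_factor[OF col]) (rule that)
    have f_elem: "f (elem_tensor \<tau> L M (\<theta> k s) y) = \<sigma> k (elem_tensor \<tau> (S k) M s y)"
      if "s \<in> carrier (S k)" "y \<in> carrier M" for k s y
      using f[OF elem_tensor_closed[OF _ _ that]] that by (simp add: tensor_map_elem)
    have "f (diag_lim k v) = \<rho> k v" if v: "v \<in> carrier (diag k)" for k v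
      by (rule ucp_eq_on_tensors[OF _ _ _ ucp_comp[OF ucp_tensor_map uf] u\<rho> _ v])
         (simp_all add: tensor_map_elem f_elem \<sigma>_elem \<rho>'_elem[where n = k])
    moreover have "g y = f y"
      if ug: "ucp (tensor_sys \<tau> L M) R g"
        and g: "\<And>k v. v \<in> carrier (diag k) \<Longrightarrow> g (diag_lim k v) = \<rho> k v"
        and y: "y \<in> carrier (tensor_sys \<tau> L M)" for g y
    proof (rule inductive_limit_map_eq[OF col osR ug uf _ y])
      fix k v assume v: "v \<in> carrier (tensor_sys \<tau> (S k) M)"
      have g_elem: "g (elem_tensor \<tau> L M (\<theta> k s) (\<eta> j x)) = \<rho>' k j (elem_tensor \<tau> (S k) (T j) s x)"
        if s: "s \<in> carrier (S k)" and x: "x \<in> carrier (T j)" for s j x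
      proof -
        \<comment> \<open>Only diagonal tensors are controlled by the assumption on \<open>g\<close>, so both legs are first
          moved to a common stage.\<close>
        let ?n = "max k j"
        let ?s = "transition \<phi> k ?n s" and ?x = "transition \<psi> j ?n x"
        have "g (elem_tensor \<tau> L M (\<theta> ?n ?s) (\<eta> ?n ?x)) = \<rho> ?n (elem_tensor \<tau> (S ?n) (T ?n) ?s ?x)"
          using g[OF elem_tensor_closed, of ?n ?s ?x] s x by (simp add: tensor_map_elem)
        then show ?thesis
          using s x by (simp add: \<rho>'_elem[where n = ?n] cocone_transition[OF S cocones(1)]
              cocone_transition[OF T cocones(2)])
      qed
      show "g (tensor_map \<tau> (S k) M L M (\<theta> k) id v) = f (tensor_map \<tau> (S k) M L M (\<theta> k) id v)"
        by (rule row_eq[OF ucp_comp[OF ucp_tensor_map ug] ucp_comp[OF ucp_tensor_map uf] _ v])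
           (simp_all add: tensor_map_elem g_elem f_elem \<sigma>_elem)
    qed
    ultimately show ?thesis using uf by blast
  qed
  then show ?thesis
    using cocone_diag_lim unfolding inductive_limit_def by blast
qed

end


theorem lemma4p4:
  fixes \<tau> :: "'u tensor"
    and S T :: "nat \<Rightarrow> 'u opsys" and \<phi> \<psi> :: "nat \<Rightarrow> 'u \<Rightarrow> 'u"
    and S_lim T_lim :: "'u opsys" and \<phi>_lim \<psi>_lim :: "nat \<Rightarrow> 'u \<Rightarrow> 'u"
  assumes "operator_system_tensor_product \<tau>"
    and "commutes_with_inductive_limits \<tau>"
    and "inductive_sequence S \<phi>" and "inductive_limit S \<phi> S_lim \<phi>_lim"
    and "inductive_sequence T \<psi>" and "inductive_limit T \<psi> T_lim \<psi>_lim"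
  shows "limit_canonically_iso
    (\<lambda>k. tensor_sys \<tau> (S k) (T k))
    (\<lambda>k. tensor_map \<tau> (S k) (T k) (S (Suc k)) (T (Suc k)) (\<phi> k) (\<psi> k))
    (tensor_sys \<tau> S_lim T_lim)
    (\<lambda>k. tensor_map \<tau> (S k) (T k) S_lim T_lim (\<phi>_lim k) (\<psi>_lim k))"
proof -
  interpret double_sequence \<tau> S T \<phi> \<psi> S_lim T_lim \<phi>_lim \<psi>_lim
    using assms by unfold_locales
  show ?thesis
    by (rule limit_canonically_isoI[OF inductive_sequence_diagonal inductive_limit_diagonal])
qed

end
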